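(* For every $w\in\beta\mathbb Z\setminus\{0\}$, the following are equivalent. (1) The ultrafilter $w$ is self-divisible. (2) The relations $\equiv_w$ and $\equiv^{\mathrm s}_w$ on $\beta\mathbb Z$ coincide. (3) The relation $\equiv_w$ is an equivalence relation. (4) For every $u\in\beta\mathbb Z$, we have $w\mathrel{\tilde\mid}u$ if and only if $D(w)\subseteq D(u)$. (5) For every $a,b\models w$ there is $c\models w$ such that $c\mid\gcd(a,b)$.
   Context: $\beta\mathbb Z$ is the space of ultrafilters on $\mathbb Z$; integers are identified with principal ultrafilters. For $u,v\in\beta\mathbb Z$: $A\in u\otimes v$ iff $\{x:\{y:(x,y)\in A\}\in v\}\in u$ (for $A\subseteq\mathbb Z^2$; similarly for more factors); $A\in u\oplus v$ iff $\{x:\{y:x+y\in A\}\in v\}\in u$; $-u=\{-A:A\in u\}$; $u\ominus v=u\oplus(-v)$. Fix an elementary extension ${}^{*}\mathbb Z$ of $\mathbb Z$, in the language with a symbol for every subset of every $\mathbb Z^k$, that is $(2^{\aleph_0})^+$-saturated. For a tuple $a$ in ${}^{*}\mathbb Z$ and an ultrafilter $u$ on $\mathbb Z^k$, $a\models u$ ("$a$ realises $u$") means $u=\{A\subseteq\mathbb Z^k:a\in{}^{*}A\}$. Divisibility and gcd of elements of ${}^{*}\mathbb Z$ are taken in ${}^{*}\mathbb Z$. - $u\mathrel{\tilde\mid}v$ iff there are $a\models u$, $b\models v$ with $a\mid b$; equivalently, every $A\in u$ that is upward closed under divisibility belongs to $v$. - For $w\neq0$: $u\equiv_w v$ iff there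 are $d\models w$ and $(a,b)\models u\otimes v$ with $d\mid a-b$; equivalently, $w\mathrel{\tilde\mid}u\ominus v$. - For $w\ne0$: $u\equiv^{\mathrm s}_w v$ iff there is (equivalently, for every) $(d,a,b)\models w\otimes u\otimes v$ one has $d\mid a-b$; equivalently, $\{n\in\mathbb Z:n\mathbb Z\in u\ominus v\}\in w$. - $D(u)=\{n\in\mathbb Z:n\mathbb Z\in u\}$. An ultrafilter $w\in\beta\mathbb Z\setminus\{0\}$ is self-divisible iff $D(w)\in w$. *)

theory Defs
  imports Complex_Main "HOL-Library.Equipollence"
begin

section \<open>Ultrafilters\<close>

text \<open>
  Ultrafilters are filters in the sense of the library type \<open>'a filter\<close>: the set-theoretic
  \<open>A \<in> u\<close> is \<open>\<forall>\<^sub>F x in u. x \<in> A\<close>, and the principal ultrafilter at \<open>n\<close> is \<open>principal {n}\<close>.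
\<close>

definition ultrafilter :: "'a filter \<Rightarrow> bool" where
  "ultrafilter u \<longleftrightarrow> u \<noteq> bot \<and> (\<forall>A. (\<forall>\<^sub>F x in u. x \<in> A) \<or> (\<forall>\<^sub>F x in u. x \<notin> A))"

definition betaZ :: "int filter set" where
  "betaZ = {u. ultrafilter u}"

text \<open>
  The tensor product of more than two factors is obtained by nesting to the right, matching the
  nesting of tuples.
\<close>

definition tensor :: "'a filter \<Rightarrow> 'b filter \<Rightarrow> ('a \<times> 'b) filter"  (infixr "\<otimes>" 70) where
  "u \<otimes> v = Abs_filter (\<lambda>P. \<forall>\<^sub>F x in u. \<forall>\<^sub>F y in v. P (x, y))"

lemma eventually_tensor:
  "eventually P (u \<otimes> v) \<longleftrightarrow> (\<forall>\<^sub>F x in u. \<forall>\<^sub>F y in v. P (x, y))"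
  unfolding tensor_def
proof (rule eventually_Abs_filter, rule is_filter.intro)
  fix P Q :: "'a \<times> 'b \<Rightarrow> bool"
  assume "\<forall>\<^sub>F x in u. \<forall>\<^sub>F y in v. P (x, y)" and "\<forall>\<^sub>F x in u. \<forall>\<^sub>F y in v. Q (x, y)"
  then show "\<forall>\<^sub>F x in u. \<forall>\<^sub>F y in v. P (x, y) \<and> Q (x, y)"
    by eventually_elim (rule eventually_conj)
next
  fix P Q :: "'a \<times> 'b \<Rightarrow> bool"
  assume "\<forall>p. P p \<longrightarrow> Q p" and "\<forall>\<^sub>F x in u. \<forall>\<^sub>F y in v. P (x, y)"
  then show "\<forall>\<^sub>F x in u. \<forall>\<^sub>F y in v. Q (x, y)"
    by (auto elim!: eventually_mono)
qed simp

definition D :: "int filter \<Rightarrow> int set" where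
  "D u = {n. \<forall>\<^sub>F x in u. x \<in> range (\<lambda>k. n * k)}"

definition self_divisible :: "int filter \<Rightarrow> bool" where
  "self_divisible w \<longleftrightarrow> (\<forall>\<^sub>F n in w. n \<in> D w)"


section \<open>Saturated elementary extensions of the integers\<close>

text \<open>
  First-order formulas over the language with a relation symbol for every subset of every
  \<open>\<int>\<^sup>k\<close>. Elements of \<open>\<int>\<^sup>k\<close> are lists of length \<open>k\<close>, and a subset of \<open>\<int>\<^sup>k\<close> serves as its own
  symbol. No function or constant symbols are needed, since graphs and singletons are available.
\<close>

datatype fm =
    Rel "int list set" "nat list"
  | Eq nat nat
  | Neg fm
  | Conj fm fm
  | Ex nat fm

primrec wf_fm :: "fm \<Rightarrow> bool" where
  "wf_fm (Rel A xs) \<longleftrightarrow> A \<subseteq> {t. length t = length xs}"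
| "wf_fm (Eq x y) \<longleftrightarrow> True"
| "wf_fm (Neg p) \<longleftrightarrow> wf_fm p"
| "wf_fm (Conj p q) \<longleftrightarrow> wf_fm p \<and> wf_fm q"
| "wf_fm (Ex x p) \<longleftrightarrow> wf_fm p"

text \<open>
  A structure with universe the type \<open>'a\<close> is given by its interpretation \<open>A \<mapsto> *A\<close> of the symbols.
  The standard structure is \<open>id :: int structure\<close>.
\<close>

type_synonym 'a "structure" = "int list set \<Rightarrow> 'a list set"

definition is_structure :: "'a structure \<Rightarrow> bool" where
  "is_structure S \<longleftrightarrow> (\<forall>k A. A \<subseteq> {t. length t = k} \<longrightarrow> S A \<subseteq> {t. length t = k})"

primrec sat :: "'a structure \<Rightarrow> (nat \<Rightarrow> 'a) \<Rightarrow> fm \<Rightarrow> bool" where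
  "sat S s (Rel A xs) \<longleftrightarrow> map s xs \<in> S A"
| "sat S s (Eq x y) \<longleftrightarrow> s x = s y"
| "sat S s (Neg p) \<longleftrightarrow> \<not> sat S s p"
| "sat S s (Conj p q) \<longleftrightarrow> sat S s p \<and> sat S s q"
| "sat S s (Ex x p) \<longleftrightarrow> (\<exists>a. sat S (s(x := a)) p)"

text \<open>The extension is presented by an elementary embedding \<open>j\<close> of the integers.\<close>

definition elementary_extension :: "'a structure \<Rightarrow> (int \<Rightarrow> 'a) \<Rightarrow> bool" where
  "elementary_extension S j \<longleftrightarrow> is_structure S \<and>
     (\<forall>p s. wf_fm p \<longrightarrow> (sat id s p \<longleftrightarrow> sat S (j \<circ> s) p))"

text \<open>
  \<open>(2\<^sup>\<aleph>\<^sup>0)\<^sup>+\<close>-saturation: every finitely satisfiable 1-type over a set \<open>B\<close> of at most \<open>2\<^sup>\<aleph>\<^sup>0\<close>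
  parameters is realised. A formula with parameters is a formula together with an assignment;
  variable \<open>0\<close> is the variable of the type, and all others are assigned parameters.
\<close>

definition saturated :: "'a structure \<Rightarrow> bool" where
  "saturated S \<longleftrightarrow>
     (\<forall>B \<Phi>. B \<lesssim> (UNIV :: nat set set) \<longrightarrow>
        (\<forall>(p, s) \<in> \<Phi>. wf_fm p \<and> (\<forall>n>0. s n \<in> B)) \<longrightarrow>
        (\<forall>\<Psi>\<subseteq>\<Phi>. finite \<Psi> \<longrightarrow> (\<exists>a. \<forall>(p, s) \<in> \<Psi>. sat S (s(0 := a)) p)) \<longrightarrow>
        (\<exists>a. \<forall>(p, s) \<in> \<Phi>. sat S (s(0 := a)) p))"

text \<open>The sets \<open>*A\<close> for sets \<open>A\<close> of integers, of pairs and of triples.\<close>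

definition star1 :: "'a structure \<Rightarrow> int set \<Rightarrow> 'a set" where
  "star1 S A = {a. [a] \<in> S {[x] | x. x \<in> A}}"

definition star2 :: "'a structure \<Rightarrow> (int \<times> int) set \<Rightarrow> ('a \<times> 'a) set" where
  "star2 S A = {(a, b). [a, b] \<in> S {[x, y] | x y. (x, y) \<in> A}}"

definition star3 :: "'a structure \<Rightarrow> (int \<times> int \<times> int) set \<Rightarrow> ('a \<times> 'a \<times> 'a) set" where
  "star3 S A = {(a, b, c). [a, b, c] \<in> S {[x, y, z] | x y z. (x, y, z) \<in> A}}"

text \<open>
  The extension of a binary operation on the integers, through its graph; by elementarity the
  graph still defines a total function, so the description is proper.
\<close>

definition star_op :: "'a structure \<Rightarrow> (int \<Rightarrow> int \<Rightarrow> int) \<Rightarrow> 'a \<Rightarrow> 'a \<Rightarrow> 'a" where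
  "star_op S f a b = (THE c. (a, b, c) \<in> star3 S {(x, y, z). z = f x y})"

lemma star_op_unique:
  assumes "elementary_extension S j"
  shows "\<exists>!c. (a, b, c) \<in> star3 S {(x, y, z). z = f x y}"
proof -
  define G where "G = {[x, y, z] | x y z. z = f x y}"
  let ?ex = "Ex 2 (Rel G [0, 1, 2])"
  let ?un = "Conj (Conj (Rel G [0, 1, 2]) (Rel G [0, 1, 3])) (Neg (Eq 2 3))"
  let ?p = "Ex 0 (Ex 1 (Neg ?ex))" and ?q = "Ex 0 (Ex 1 (Ex 2 (Ex 3 ?un)))"
  have "wf_fm ?p" "wf_fm ?q" by (auto simp: G_def)
  moreover have "\<not> sat id (\<lambda>_. 0) ?p" "\<not> sat id (\<lambda>_. 0) ?q" by (auto simp: G_def)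
  ultimately have "\<not> sat S (j \<circ> (\<lambda>_. 0)) ?p" "\<not> sat S (j \<circ> (\<lambda>_. 0)) ?q"
    using assms unfolding elementary_extension_def by blast+
  then have "\<exists>c. [a, b, c] \<in> S G" "\<And>c d. [a, b, c] \<in> S G \<Longrightarrow> [a, b, d] \<in> S G \<Longrightarrow> c = d"
    by auto
  then show ?thesis by (auto simp: star3_def G_def)
qed

definition star_dvd :: "'a structure \<Rightarrow> 'a \<Rightarrow> 'a \<Rightarrow> bool" where
  "star_dvd S a b \<longleftrightarrow> (\<exists>c. b = star_op S (*) a c)"

definition star_diff :: "'a structure \<Rightarrow> 'a \<Rightarrow> 'a \<Rightarrow> 'a" where
  "star_diff S = star_op S (-)"

definition star_gcd :: "'a structure \<Rightarrow> 'a \<Rightarrow> 'a \<Rightarrow> 'a" where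
  "star_gcd S = star_op S gcd"


section \<open>Realisations and the relations between ultrafilters\<close>

definition realises1 :: "'a structure \<Rightarrow> 'a \<Rightarrow> int filter \<Rightarrow> bool" where
  "realises1 S a u \<longleftrightarrow> (\<forall>A. (\<forall>\<^sub>F x in u. x \<in> A) \<longleftrightarrow> a \<in> star1 S A)"

definition realises2 :: "'a structure \<Rightarrow> 'a \<times> 'a \<Rightarrow> (int \<times> int) filter \<Rightarrow> bool" where
  "realises2 S a u \<longleftrightarrow> (\<forall>A. (\<forall>\<^sub>F x in u. x \<in> A) \<longleftrightarrow> a \<in> star2 S A)"

definition realises3 :: "'a structure \<Rightarrow> 'a \<times> 'a \<times> 'a \<Rightarrow> (int \<times> int \<times> int) filter \<Rightarrow> bool" where
  "realises3 S a u \<longleftrightarrow> (\<forall>A. (\<forall>\<^sub>F x in u. x \<in> A) \<longleftrightarrow> a \<in> star3 S A)"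

definition tilde_dvd :: "'a structure \<Rightarrow> int filter \<Rightarrow> int filter \<Rightarrow> bool" where
  "tilde_dvd S u v \<longleftrightarrow> (\<exists>a b. realises1 S a u \<and> realises1 S b v \<and> star_dvd S a b)"

definition cong_uf :: "'a structure \<Rightarrow> int filter \<Rightarrow> int filter \<Rightarrow> int filter \<Rightarrow> bool" where
  "cong_uf S w u v \<longleftrightarrow>
     (\<exists>d a b. realises1 S d w \<and> realises2 S (a, b) (u \<otimes> v) \<and> star_dvd S d (star_diff S a b))"

definition strong_cong_uf :: "'a structure \<Rightarrow> int filter \<Rightarrow> int filter \<Rightarrow> int filter \<Rightarrow> bool" where
  "strong_cong_uf S w u v \<longleftrightarrow>
     (\<exists>d a b. realises3 S (d, a, b) (w \<otimes> u \<otimes> v) \<and> star_dvd S d (star_diff S a b))"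

end

theory Submission
  imports Defs
begin

text \<open>
  Saturation turns each relation into a statement about ultrafilters only: there is a realisation
  of \<open>w\<close> in a given relation to a tuple iff, for every \<open>A\<close> in \<open>w\<close>, the tuple lies in the
  extension of the set of integer tuples related to some member of \<open>A\<close>.

  If \<open>D w\<close> belongs to \<open>w\<close>, then \<open>A\<close> may be shrunk to elements of \<open>D w\<close>, which gives (2), (4)
  and (5); (3) follows from (2) because the strong congruence is always an equivalence.

  Conversely, as \<open>D w\<close> is closed under divisors and least common multiples, some ultrafilter \<open>t\<close>
  contains \<open>D w\<close> and \<open>n \<int>\<close> for each \<open>n\<close> in \<open>D w\<close>; if \<open>w\<close> divides \<open>t\<close>, then every member of \<open>w\<close>
  meets \<open>D w\<close>, so \<open>D w\<close> is in \<open>w\<close>. Under (4) this divisibility is immediate. Under (3) it comes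
  from an \<open>s\<close> congruent to both \<open>0\<close> and \<open>t\<close>, built with the Chinese remainder theorem. Under (5),
  apply the hypothesis to a tensor pair realising \<open>w \<otimes> w\<close>: its gcd plays the role of \<open>t\<close>.
\<close>

section \<open>Ultrafilters\<close>

text \<open>In this form negation commutes with \<open>eventually\<close>, which makes a usable
  rewrite rule; properness of the filter excludes that a predicate and its negation both hold
  eventually.\<close>

lemma ultrafilter_iff:
  "ultrafilter u \<longleftrightarrow> u \<noteq> bot \<and> (\<forall>P. eventually (\<lambda>x. \<not> P x) u \<longleftrightarrow> \<not> eventually P u)"
proof
  assume *: "ultrafilter u"
  have "eventually P u \<or> eventually (\<lambda>x. \<not> P x) u" for P
  proof -
    from * have "(\<forall>\<^sub>F x in u. x \<in> Collect P) \<or> (\<forall>\<^sub>F x in u. x \<notin> Collect P)"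
      unfolding ultrafilter_def by blast
    then show ?thesis by simp
  qed
  moreover have "False" if "eventually P u" "eventually (\<lambda>x. \<not> P x) u" for P
    using eventually_conj[OF that] * by (simp add: ultrafilter_def trivial_limit_def)
  ultimately show "u \<noteq> bot \<and> (\<forall>P. eventually (\<lambda>x. \<not> P x) u \<longleftrightarrow> \<not> eventually P u)"
    using * unfolding ultrafilter_def by blast
next
  assume "u \<noteq> bot \<and> (\<forall>P. eventually (\<lambda>x. \<not> P x) u \<longleftrightarrow> \<not> eventually P u)"
  then show "ultrafilter u" unfolding ultrafilter_def by blast
qed

lemma ultrafilter_tensor:
  assumes "ultrafilter u" and "ultrafilter v"
  shows "ultrafilter (u \<otimes> v)"
  using assms unfolding ultrafilter_iff trivial_limit_def eventually_tensor by simp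

lemma ultrafilter_principal: "ultrafilter (principal {x})"
  by (simp add: ultrafilter_iff eventually_principal principal_eq_bot_iff)


section \<open>Transfer\<close>

primrec vars :: "fm \<Rightarrow> nat set" where
  "vars (Rel A xs) = set xs"
| "vars (Eq x y) = {x, y}"
| "vars (Neg p) = vars p"
| "vars (Conj p q) = vars p \<union> vars q"
| "vars (Ex x p) = insert x (vars p)"

lemma finite_vars: "finite (vars p)"
  by (induction p) auto

lemma sat_cong: "(\<And>x. x \<in> vars p \<Longrightarrow> s x = t x) \<Longrightarrow> sat S s p \<longleftrightarrow> sat S t p"
proof (induction p arbitrary: s t)
  case (Rel A xs)
  then have "map s xs = map t xs" by simp
  then show ?case by (simp only: sat.simps)
next
  case (Conj p q)
  have "sat S s p \<longleftrightarrow> sat S t p" "sat S s q \<longleftrightarrow> sat S t q"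
    using Conj.prems by (auto intro!: Conj.IH)
  then show ?case by simp
next
  case (Ex x p)
  have "sat S (s(x := a)) p \<longleftrightarrow> sat S (t(x := a)) p" for a
    using Ex.prems by (intro Ex.IH) auto
  then show ?case by simp
next
  case (Neg p)
  have "sat S s p \<longleftrightarrow> sat S t p"
    using Neg.prems by (intro Neg.IH) auto
  then show ?case by simp
qed simp_all

text \<open>Elementarity speaks only of assignments of the form \<open>j \<circ> s\<close>. Closing
  \<open>p\<close> universally over the variables in \<open>xs\<close>, one at a time, reaches every
  \<open>t\<close>; at the end \<open>t\<close> is constantly \<open>j 0\<close>.\<close>

lemma valid_transfer_aux:
  assumes "elementary_extension S j"
    and "wf_fm p" and "\<And>s. sat id s p" and "\<And>x. x \<notin> set xs \<Longrightarrow> t x = j 0"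
  shows "sat S t p"
  using assms(2-)
proof (induction xs arbitrary: p t)
  case Nil
  then have "t = j \<circ> (\<lambda>_. 0)" by auto
  with Nil assms(1) show ?case
    unfolding elementary_extension_def by blast
next
  case (Cons x xs)
  have "sat S (t(x := j 0)) (Neg (Ex x (Neg p)))"
    using Cons.prems by (intro Cons.IH) auto
  then have "sat S (t(x := j 0, x := t x)) p" unfolding sat.simps by blast
  then show ?case by simp
qed

lemma valid_transfer:
  assumes "elementary_extension S j" and "wf_fm p" and "\<And>s. sat id s p"
  shows "sat S t p"
proof -
  obtain xs where xs: "set xs = vars p"
    using finite_list[OF finite_vars] by blast
  \<comment> \<open>Only the finitely many variables of \<open>p\<close> matter, so \<open>t\<close>
    may be reset to \<open>j 0\<close> elsewhere.\<close>
  have "sat S (\<lambda>x. if x \<in> set xs then t x else j 0) p"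
    using assms by (rule valid_transfer_aux[where xs = xs]) auto
  also have "?this \<longleftrightarrow> sat S t p"
    by (rule sat_cong) (simp add: xs)
  finally show ?thesis .
qed

lemma all_mem_iff: "(\<forall>A. Q (\<lambda>x. x \<in> A)) \<longleftrightarrow> (\<forall>P. Q P)"
proof safe
  fix P assume "\<forall>A. Q (\<lambda>x. x \<in> A)"
  from spec[OF this, of "Collect P"] show "Q P" by simp
qed blast

text \<open>Cutting a predicate down to the right length spares side conditions on arities.\<close>

definition ext :: "'a structure \<Rightarrow> (int list \<Rightarrow> bool) \<Rightarrow> 'a list \<Rightarrow> bool" where
  "ext S P as \<longleftrightarrow> as \<in> S {l. length l = length as \<and> P l}"

definition rel :: "(int list \<Rightarrow> bool) \<Rightarrow> nat list \<Rightarrow> fm" where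
  "rel P xs = Rel {l. length l = length xs \<and> P l} xs"

lemma wf_rel [simp]: "wf_fm (rel P xs)"
  by (auto simp: rel_def)

lemma sat_rel: "sat S s (rel P xs) \<longleftrightarrow> ext S P (map s xs)"
  by (simp add: rel_def ext_def)

lemma ext_id [simp]: "ext id P l \<longleftrightarrow> P l"
  by (simp add: ext_def)

lemma map_nth_upt: "map (\<lambda>i. if i < length l then l ! i else d i) [0..<length l] = l"
  by (rule nth_equalityI) auto

section \<open>Boolean operations, substitution and quantifiers for extensions of predicates\<close>

context
  fixes S :: "'a structure" and j :: "int \<Rightarrow> 'a"
  assumes el: "elementary_extension S j"
begin

lemma ext_not: "ext S (\<lambda>l. \<not> P l) as \<longleftrightarrow> \<not> ext S P as"
proof -
  let ?r = "\<lambda>P. rel P [0..<length as]"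
  let ?p = "?r (\<lambda>l. \<not> P l)" and ?q = "Neg (?r P)"
  \<comment> \<open>Variable \<open>i\<close> is read as the \<open>i\<close>-th entry of
    \<open>as\<close>. The formula is the biconditional of \<open>?p\<close> and \<open>?q\<close>,
    spelled with the connectives at hand; it is valid in the integers and transfers.\<close>
  have "sat S (\<lambda>i. if i < length as then as ! i else j 0)
          (Conj (Neg (Conj ?p (Neg ?q))) (Neg (Conj ?q (Neg ?p))))"
    by (rule valid_transfer[OF el]) (auto simp: sat_rel)
  then show ?thesis by (auto simp: sat_rel map_nth_upt)
qed

lemma ext_conj: "ext S (\<lambda>l. P l \<and> Q l) as \<longleftrightarrow> ext S P as \<and> ext S Q as"
proof -
  let ?r = "\<lambda>P. rel P [0..<length as]"
  let ?p = "?r (\<lambda>l. P l \<and> Q l)" and ?q = "Conj (?r P) (?r Q)"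
  have "sat S (\<lambda>i. if i < length as then as ! i else j 0)
          (Conj (Neg (Conj ?p (Neg ?q))) (Neg (Conj ?q (Neg ?p))))"
    by (rule valid_transfer[OF el]) (auto simp: sat_rel)
  then show ?thesis by (auto simp: sat_rel map_nth_upt)
qed

text \<open>The variable list of an atomic formula carries out the substitution:
  \<open>rel P is\<close> applies \<open>P\<close> to the selected coordinates. Thus coordinates may
  be permuted, repeated or dropped.\<close>

lemma ext_map:
  assumes "\<forall>i\<in>set is. i < length as"
  shows "ext S (\<lambda>l. P (map ((!) l) is)) as \<longleftrightarrow> ext S P (map ((!) as) is)"
proof -
  let ?p = "rel (\<lambda>l. P (map ((!) l) is)) [0..<length as]" and ?q = "rel P is"
  have 1: "map ((!) (map s [0..<length as])) is = map s is" for s :: "nat \<Rightarrow> int"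
    using assms by auto
  have 2: "map (\<lambda>i. if i < length as then as ! i else j 0) is = map ((!) as) is"
    using assms by auto
  have "sat S (\<lambda>i. if i < length as then as ! i else j 0)
          (Conj (Neg (Conj ?p (Neg ?q))) (Neg (Conj ?q (Neg ?p))))"
    by (rule valid_transfer[OF el]) (auto simp: sat_rel 1)
  then show ?thesis by (auto simp: sat_rel map_nth_upt 2)
qed

lemma ext_Ex: "ext S (\<lambda>l. \<exists>x. P (x # l)) as \<longleftrightarrow> (\<exists>a. ext S P (a # as))"
proof -
  let ?n = "length as"
  let ?t = "\<lambda>i. if i < ?n then as ! i else j 0"
  \<comment> \<open>\<open>?n\<close> is fresh for the variables below it; it comes first in the
    atom because the quantified entry is the head of the list.\<close>
  let ?p = "rel (\<lambda>l. \<exists>x. P (x # l)) [0..<?n]" and ?q = "Ex ?n (rel P (?n # [0..<?n]))"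
  have upd: "map (s(?n := a)) [0..<?n] = map s [0..<?n]" for s :: "nat \<Rightarrow> 'b" and a
    by simp
  have "sat S ?t (Conj (Neg (Conj ?p (Neg ?q))) (Neg (Conj ?q (Neg ?p))))"
    by (rule valid_transfer[OF el]) (auto simp: sat_rel upd fun_upd_same simp del: fun_upd_apply)
  moreover have "map (?t(?n := a)) [0..<?n] = as" for a
    by (rule nth_equalityI) auto
  ultimately show ?thesis
    by (auto simp: sat_rel map_nth_upt fun_upd_same simp del: fun_upd_apply)
qed

text \<open>On lists of the right length \<open>P\<close> coincides with the conjunction of
  \<open>P\<close> and \<open>Q\<close>, and extensions respect conjunctions.\<close>

lemma ext_mono:
  assumes "ext S P as" and "\<And>l. length l = length as \<Longrightarrow> P l \<Longrightarrow> Q l"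
  shows "ext S Q as"
proof -
  have "{l. length l = length as \<and> P l} = {l. length l = length as \<and> P l \<and> Q l}"
    using assms(2) by auto
  then have "ext S P as \<longleftrightarrow> ext S (\<lambda>l. P l \<and> Q l) as" by (simp add: ext_def)
  then show ?thesis using assms(1) by (simp add: ext_conj)
qed

lemma ext_cong:
  assumes "\<And>l. length l = length as \<Longrightarrow> P l \<longleftrightarrow> Q l"
  shows "ext S P as \<longleftrightarrow> ext S Q as"
  using ext_mono[of P as Q] ext_mono[of Q as P] assms by blast

lemma ext_const: "ext S (\<lambda>_. c) as \<longleftrightarrow> c"
proof -
  have "ext S (\<lambda>_. True) as"
    using ext_not[of "\<lambda>_. True" as] ext_mono[of "\<lambda>_. False" as "\<lambda>_. True"] by auto
  then show ?thesis using ext_not[of "\<lambda>_. True" as] by (cases c) auto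
qed


section \<open>Divisibility in the extension\<close>

lemma star_op_iff: "star_op S f a b = c \<longleftrightarrow> ext S (\<lambda>l. l ! 2 = f (l ! 0) (l ! 1)) [a, b, c]"
proof -
  have "{[x, y, z] | x y z. (x, y, z) \<in> {(x, y, z). z = f x y}} =
      {l. length l = length [a, b, c] \<and> l ! 2 = f (l ! 0) (l ! 1)}"
    by (auto simp: length_Suc_conv numeral_2_eq_2 numeral_3_eq_3)
  then have *: "(a, b, c) \<in> star3 S {(x, y, z). z = f x y} \<longleftrightarrow>
      ext S (\<lambda>l. l ! 2 = f (l ! 0) (l ! 1)) [a, b, c]" for c
    by (simp add: star3_def ext_def)
  show ?thesis
    using theI'[OF star_op_unique[OF el, of a b f]] star_op_unique[OF el, of a b f]
    unfolding star_op_def * by blast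
qed

lemma star_dvd_iff: "star_dvd S a b \<longleftrightarrow> ext S (\<lambda>l. l ! 0 dvd l ! 1) [a, b]"
proof -
  have "star_dvd S a b \<longleftrightarrow> (\<exists>c. ext S (\<lambda>l. l ! 2 = l ! 0 * l ! 1) [a, c, b])"
    unfolding star_op_iff[symmetric] star_dvd_def by blast
  \<comment> \<open>The cofactor is moved to the front, where \<open>ext_Ex\<close> can quantify
    it.\<close>
  also have "\<dots> \<longleftrightarrow> (\<exists>c. ext S (\<lambda>l. l ! 2 = l ! 1 * l ! 0) [c, a, b])"
  proof -
    have "ext S (\<lambda>l. l ! 2 = l ! 1 * l ! 0) [c, a, b] \<longleftrightarrow>
        ext S (\<lambda>l. l ! 2 = l ! 0 * l ! 1) [a, c, b]" for c
      using ext_map[of "[1, 0, 2]" "[c, a, b]" "\<lambda>l. l ! 2 = l ! 0 * l ! 1"] by simp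
    then show ?thesis by blast
  qed
  also have "\<dots> \<longleftrightarrow> ext S (\<lambda>l. \<exists>c. (c # l) ! 2 = (c # l) ! 1 * (c # l) ! 0) [a, b]"
    by (rule ext_Ex[symmetric])
  also have "\<dots> \<longleftrightarrow> ext S (\<lambda>l. l ! 0 dvd l ! 1) [a, b]"
    by (rule ext_cong) (auto simp: dvd_def)
  finally show ?thesis .
qed

text \<open>The value of the operation is named \<open>e\<close> through its graph; transferring the
  quantifier over \<open>e\<close> eliminates it.\<close>

lemma star_dvd_op_iff:
  "star_dvd S d (star_op S f a b) \<longleftrightarrow> ext S (\<lambda>l. l ! 0 dvd f (l ! 1) (l ! 2)) [d, a, b]"
proof -
  have "star_dvd S d (star_op S f a b) \<longleftrightarrow>
      (\<exists>e. ext S (\<lambda>l. l ! 2 = f (l ! 0) (l ! 1)) [a, b, e] \<and> ext S (\<lambda>l. l ! 0 dvd l ! 1) [d, e])"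
    unfolding star_op_iff[symmetric] star_dvd_iff[symmetric] by blast
  also have "\<dots> \<longleftrightarrow> (\<exists>e. ext S (\<lambda>l. l ! 0 = f (l ! 2) (l ! 3) \<and> l ! 1 dvd l ! 0) [e, d, a, b])"
  proof -
    have "ext S (\<lambda>l. l ! 0 = f (l ! 2) (l ! 3)) [e, d, a, b] \<longleftrightarrow>
        ext S (\<lambda>l. l ! 2 = f (l ! 0) (l ! 1)) [a, b, e]" for e
      using ext_map[of "[2, 3, 0]" "[e, d, a, b]" "\<lambda>l. l ! 2 = f (l ! 0) (l ! 1)"] by simp
    moreover have "ext S (\<lambda>l. l ! 1 dvd l ! 0) [e, d, a, b] \<longleftrightarrow>
        ext S (\<lambda>l. l ! 0 dvd l ! 1) [d, e]" for e
      using ext_map[of "[1, 0]" "[e, d, a, b]" "\<lambda>l. l ! 0 dvd l ! 1"] by simp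
    ultimately show ?thesis by (simp only: ext_conj)
  qed
  also have "\<dots> \<longleftrightarrow>
      ext S (\<lambda>l. \<exists>e. (e # l) ! 0 = f ((e # l) ! 2) ((e # l) ! 3) \<and> (e # l) ! 1 dvd (e # l) ! 0)
        [d, a, b]"
    by (rule ext_Ex[symmetric])
  also have "\<dots> \<longleftrightarrow> ext S (\<lambda>l. l ! 0 dvd f (l ! 1) (l ! 2)) [d, a, b]"
    by (rule ext_cong) (auto simp: numeral_2_eq_2 numeral_3_eq_3)
  finally show ?thesis .
qed


section \<open>Realising filters\<close>

lemma ext_star1: "a \<in> star1 S A \<longleftrightarrow> ext S (\<lambda>l. l ! 0 \<in> A) [a]"
proof -
  have "{[x] | x. x \<in> A} = {l. length l = length [a] \<and> l ! 0 \<in> A}"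
    by (auto simp: length_Suc_conv)
  then show ?thesis by (simp add: star1_def ext_def)
qed

lemma ext_star2: "(a, b) \<in> star2 S A \<longleftrightarrow> ext S (\<lambda>l. (l ! 0, l ! 1) \<in> A) [a, b]"
proof -
  have "{[x, y] | x y. (x, y) \<in> A} = {l. length l = length [a, b] \<and> (l ! 0, l ! 1) \<in> A}"
    by (auto simp: length_Suc_conv)
  then show ?thesis by (simp add: star2_def ext_def)
qed

lemma ext_star3:
  "(a, b, c) \<in> star3 S A \<longleftrightarrow> ext S (\<lambda>l. (l ! 0, l ! 1, l ! 2) \<in> A) [a, b, c]"
proof -
  have "{[x, y, z] | x y z. (x, y, z) \<in> A} =
      {l. length l = length [a, b, c] \<and> (l ! 0, l ! 1, l ! 2) \<in> A}"
    by (auto simp: length_Suc_conv numeral_2_eq_2 numeral_3_eq_3)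
  then show ?thesis by (simp add: star3_def ext_def)
qed

lemma realises1_iff:
  "realises1 S a u \<longleftrightarrow> (\<forall>P. eventually P u \<longleftrightarrow> ext S (\<lambda>l. P (l ! 0)) [a])"
  unfolding realises1_def ext_star1 by (rule all_mem_iff)

lemma realises2_iff:
  "realises2 S (a, b) u \<longleftrightarrow> (\<forall>P. eventually P u \<longleftrightarrow> ext S (\<lambda>l. P (l ! 0, l ! 1)) [a, b])"
  unfolding realises2_def ext_star2 by (rule all_mem_iff)

lemma realises3_iff:
  "realises3 S (a, b, c) u \<longleftrightarrow>
     (\<forall>P. eventually P u \<longleftrightarrow> ext S (\<lambda>l. P (l ! 0, l ! 1, l ! 2)) [a, b, c])"
  unfolding realises3_def ext_star3 by (rule all_mem_iff)

end

section \<open>Saturation and the realisation of filters\<close>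

context
  fixes S :: "'a structure" and j :: "int \<Rightarrow> 'a"
  assumes el: "elementary_extension S j" and sat: "saturated S"
begin

text \<open>The formulas \<open>P (x # as)\<close>, for \<open>P\<close> in \<open>F\<close>, form a
  type in \<open>x\<close> over the entries of \<open>as\<close>. The conjunction of finitely many
  such \<open>P\<close> is again in \<open>F\<close>, so the hypothesis for single predicates gives
  finite satisfiability.\<close>

lemma realise_over:
  assumes "\<And>P. eventually P F \<Longrightarrow> ext S (\<lambda>l. \<exists>x. P (x # l)) as"
  shows "\<exists>a. \<forall>P. eventually P F \<longrightarrow> ext S P (a # as)"
proof -
  define n where "n = length as"
  \<comment> \<open>Entries are shifted by one since variable \<open>0\<close> belongs to the type;
    \<open>j 0\<close> fills the remaining variables and is therefore put into
    \<open>B\<close>.\<close>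
  define s where "s = (\<lambda>k. if 0 < k \<and> k \<le> n then as ! (k - 1) else j 0)"
  define g where "g = (\<lambda>P. (rel P [0..<Suc n], s))"
  define B where "B = insert (j 0) (set as)"
  have s: "map (s(0 := a)) [0..<Suc n] = a # as" for a
    by (rule nth_equalityI) (auto simp: s_def n_def nth_Cons split: nat.split simp del: upt_Suc)
  have "\<exists>a. \<forall>(p, s) \<in> g ` {P. eventually P F}. sat S (s(0 := a)) p"
  proof (rule sat[unfolded saturated_def, rule_format, of B])
    show "B \<lesssim> (UNIV :: nat set set)"
      by (rule finite_lepoll_infinite) (auto simp: B_def Finite_Set.finite_set)
    show "case x of (p, s) \<Rightarrow> wf_fm p \<and> (\<forall>n>0. s n \<in> B)"
      if "x \<in> g ` {P. eventually P F}" for x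
      using that by (auto simp: g_def s_def B_def n_def)
  next
    fix \<Psi> assume "\<Psi> \<subseteq> g ` {P. eventually P F}" "finite \<Psi>"
    then obtain Ps where Ps: "Ps \<subseteq> {P. eventually P F}" "finite Ps" "\<Psi> = g ` Ps"
      using finite_subset_image by blast
    then have "eventually (\<lambda>l. \<forall>P\<in>Ps. P l) F"
      by (intro eventually_ball_finite) auto
    from assms[OF this] obtain a where a: "ext S (\<lambda>l. \<forall>P\<in>Ps. P l) (a # as)"
      using ext_Ex[OF el] by blast
    have "ext S P (a # as)" if "P \<in> Ps" for P
      using that by (intro ext_mono[OF el a]) auto
    then show "\<exists>a. \<forall>(p, s) \<in> \<Psi>. sat S (s(0 := a)) p"
      by (auto simp: Ps g_def sat_rel s simp del: upt_Suc)
  qed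
  then show ?thesis by (auto simp: g_def sat_rel s simp del: upt_Suc)
qed

text \<open>The tails are realised first, by induction, and the head is then realised over
  them.\<close>

lemma realise_filter:
  assumes "F \<noteq> bot" and "\<forall>\<^sub>F l in F. length l = n"
  shows "\<exists>as. length as = n \<and> (\<forall>P. eventually P F \<longrightarrow> ext S P as)"
  using assms
proof (induction n arbitrary: F)
  case 0
  have "ext S P []" if "eventually P F" for P
  proof -
    have "\<forall>\<^sub>F l in F. P []"
      using that 0(2) by eventually_elim simp
    then have "P []" using 0(1) by (simp add: eventually_const)
    then show ?thesis
      using ext_mono[OF el, of "\<lambda>_. True" "[]" P] ext_const[OF el] by auto
  qed
  then show ?case by auto
next
  case (Suc n)
  have "\<forall>\<^sub>F l in filtermap tl F. length l = n"
    using Suc.prems(2) by (auto simp: eventually_filtermap elim: eventually_mono)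
  then obtain as where as: "length as = n" "\<And>P. eventually P (filtermap tl F) \<Longrightarrow> ext S P as"
    using Suc.IH[of "filtermap tl F"] Suc.prems(1) by (auto simp: filtermap_bot_iff)
  have "ext S (\<lambda>l. \<exists>x. P (x # l)) as" if "eventually P F" for P
    using that Suc.prems(2)
    by (intro as, unfold eventually_filtermap, eventually_elim) (metis length_Suc_conv list.sel(3))
  from realise_over[OF this] as(1) show ?case
    by (metis length_Cons)
qed

text \<open>One implication suffices: applied to the negation of \<open>P\<close> it yields the
  other, as both \<open>u\<close> and \<open>ext\<close> decide every predicate.\<close>

lemma ext_eventually:
  assumes "ultrafilter u" and "\<And>P. eventually P u \<Longrightarrow> ext S (\<lambda>l. P (f l)) as"
  shows "eventually P u \<longleftrightarrow> ext S (\<lambda>l. P (f l)) as"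
  using assms(2)[of P] assms(2)[of "\<lambda>x. \<not> P x"] assms(1) ext_not[OF el]
  unfolding ultrafilter_iff by blast

lemma realise1:
  assumes "ultrafilter u"
  obtains a where "realises1 S a u"
proof -
  have "filtermap (\<lambda>x. [x]) u \<noteq> bot"
    using assms by (simp add: ultrafilter_def filtermap_bot_iff)
  then obtain as where as: "length as = 1"
    "\<And>P. eventually P (filtermap (\<lambda>x. [x]) u) \<Longrightarrow> ext S P as"
    using realise_filter[of _ 1] by (fastforce simp: eventually_filtermap)
  then obtain a where "as = [a]" by (auto simp: length_Suc_conv)
  with as assms have "realises1 S a u"
    unfolding realises1_iff[OF el] by (intro allI ext_eventually) (auto simp: eventually_filtermap)
  then show ?thesis by (rule that)
qed

lemma realise2:
  assumes "ultrafilter u"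
  obtains a b where "realises2 S (a, b) u"
proof -
  have "filtermap (\<lambda>(x, y). [x, y]) u \<noteq> bot"
    using assms by (simp add: ultrafilter_def filtermap_bot_iff)
  then obtain as where as: "length as = 2"
    "\<And>P. eventually P (filtermap (\<lambda>(x, y). [x, y]) u) \<Longrightarrow> ext S P as"
    using realise_filter[of _ 2] by (fastforce simp: eventually_filtermap case_prod_unfold)
  then obtain a b where "as = [a, b]" by (auto simp: length_Suc_conv numeral_2_eq_2)
  with as assms have "realises2 S (a, b) u"
    unfolding realises2_iff[OF el]
    by (intro allI ext_eventually) (auto simp: eventually_filtermap case_prod_unfold)
  then show ?thesis by (rule that)
qed

lemma realise3:
  assumes "ultrafilter u"
  obtains a b c where "realises3 S (a, b, c) u"
proof -
  have "filtermap (\<lambda>(x, y, z). [x, y, z]) u \<noteq> bot"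
    using assms by (simp add: ultrafilter_def filtermap_bot_iff)
  then obtain as where as: "length as = 3"
    "\<And>P. eventually P (filtermap (\<lambda>(x, y, z). [x, y, z]) u) \<Longrightarrow> ext S P as"
    using realise_filter[of _ 3] by (fastforce simp: eventually_filtermap case_prod_unfold)
  then obtain a b c where "as = [a, b, c]" by (auto simp: length_Suc_conv numeral_3_eq_3)
  with as assms have "realises3 S (a, b, c) u"
    unfolding realises3_iff[OF el]
    by (intro allI ext_eventually) (auto simp: eventually_filtermap case_prod_unfold)
  then show ?thesis by (rule that)
qed

text \<open>The complete type of an element at which all of \<open>F\<close> holds is an
  ultrafilter, so saturation yields the ultrafilter theorem.\<close>

lemma ultrafilter_below:
  fixes F :: "int filter"
  assumes "F \<noteq> bot"
  obtains u where "ultrafilter u" and "u \<le> F"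
proof -
  have "filtermap (\<lambda>x. [x]) F \<noteq> bot"
    using assms by (simp add: filtermap_bot_iff)
  then obtain as where as: "length as = 1"
    "\<And>P. eventually P (filtermap (\<lambda>x. [x]) F) \<Longrightarrow> ext S P as"
    using realise_filter[of _ 1] by (fastforce simp: eventually_filtermap)
  define u where "u = Abs_filter (\<lambda>P. ext S (\<lambda>l. P (l ! 0)) as)"
  have ev: "eventually P u \<longleftrightarrow> ext S (\<lambda>l. P (l ! 0)) as" for P
    unfolding u_def
  proof (rule eventually_Abs_filter, rule is_filter.intro)
    show "ext S (\<lambda>l. Q (l ! 0)) as"
      if "\<forall>x. P x \<longrightarrow> Q x" "ext S (\<lambda>l. P (l ! 0)) as" for P Q
      using that(1) by (intro ext_mono[OF el that(2)]) simp
  qed (simp_all add: ext_conj[OF el] ext_const[OF el])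
  have "ultrafilter u"
    by (simp add: ultrafilter_iff trivial_limit_def ev ext_not[OF el] ext_const[OF el])
  moreover have "u \<le> F"
    using as(2) by (auto simp: le_filter_def ev eventually_filtermap)
  ultimately show ?thesis by (rule that)
qed

lemma ex_realises1_ext_iff:
  assumes "ultrafilter w"
  shows "(\<exists>c. realises1 S c w \<and> ext S R (c # as)) \<longleftrightarrow>
    (\<forall>P. eventually P w \<longrightarrow> ext S (\<lambda>l. \<exists>n. P n \<and> R (n # l)) as)"
proof safe
  fix c P assume c: "realises1 S c w" "ext S R (c # as)" "eventually P w"
  then have "ext S (\<lambda>l. P (l ! 0)) [c]" by (simp add: realises1_iff[OF el])
  with c(2) have "ext S (\<lambda>l. P (l ! 0) \<and> R l) (c # as)"
    using ext_map[OF el, of "[0]" "c # as" "\<lambda>l. P (l ! 0)"] by (simp add: ext_conj[OF el])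
  then show "ext S (\<lambda>l. \<exists>n. P n \<and> R (n # l)) as"
    using ext_Ex[OF el, of "\<lambda>l. P (l ! 0) \<and> R l" as] by auto
next
  assume *: "\<forall>P. eventually P w \<longrightarrow> ext S (\<lambda>l. \<exists>n. P n \<and> R (n # l)) as"
  \<comment> \<open>\<open>?F\<close> demands \<open>R\<close> and that the first entry lie in every
    member of \<open>w\<close>. As \<open>w\<close> is closed under intersection, the assumption for
    single \<open>P\<close> covers every predicate in \<open>?F\<close>.\<close>
  let ?F = "inf (filtercomap (\<lambda>l. l ! 0) w) (principal {l. R l})"
  have "ext S (\<lambda>l. \<exists>n. Q (n # l)) as" if Q: "eventually Q ?F" for Q
  proof -
    obtain P where P: "eventually P w" "\<And>l. P (l ! 0) \<Longrightarrow> R l \<Longrightarrow> Q l"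
      using Q by (auto simp: eventually_inf_principal eventually_filtercomap)
    from * P(1) have *: "ext S (\<lambda>l. \<exists>n. P n \<and> R (n # l)) as" by blast
    show ?thesis by (rule ext_mono[OF el *]) (metis P(2) nth_Cons_0)
  qed
  from realise_over[OF this] obtain c where c: "\<And>Q. eventually Q ?F \<Longrightarrow> ext S Q (c # as)"
    by blast
  have "ext S R (c # as)" by (rule c) (simp add: eventually_inf_principal)
  moreover have "ext S (\<lambda>l. P (l ! 0)) [c]" if "eventually P w" for P
  proof -
    have "ext S (\<lambda>l. P (l ! 0)) (c # as)"
      using that by (intro c) (auto simp: eventually_inf_principal eventually_filtercomap
          elim: eventually_mono)
    then show ?thesis
      using ext_map[OF el, of "[0]" "c # as" "\<lambda>l. P (l ! 0)"] by simp
  qed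
  then have "realises1 S c w"
    unfolding realises1_iff[OF el] using ext_eventually[OF assms, of "\<lambda>l. l ! 0"] by blast
  ultimately show "\<exists>c. realises1 S c w \<and> ext S R (c # as)" by blast
qed

section \<open>Criteria for the relations and for common divisors in terms of ultrafilters\<close>

lemma tilde_dvd_iff:
  assumes "ultrafilter w" and "ultrafilter u"
  shows "tilde_dvd S w u \<longleftrightarrow>
    (\<forall>P. eventually P w \<longrightarrow> (\<forall>\<^sub>F y in u. \<exists>n. P n \<and> n dvd y))"
proof -
  obtain b where b: "realises1 S b u" using realise1[OF assms(2)] .
  \<comment> \<open>The right-hand side depends on \<open>b\<close> only through \<open>u\<close>,
    so one realisation of \<open>u\<close> decides for all.\<close>
  have *: "(\<exists>a. realises1 S a w \<and> star_dvd S a b) \<longleftrightarrow>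
      (\<forall>P. eventually P w \<longrightarrow> (\<forall>\<^sub>F y in u. \<exists>n. P n \<and> n dvd y))" if "realises1 S b u" for b
    using ex_realises1_ext_iff[OF assms(1), of "\<lambda>l. l ! 0 dvd l ! 1" "[b]"] that
    by (simp add: star_dvd_iff[OF el] realises1_iff[OF el])
  show ?thesis unfolding tilde_dvd_def using * b by blast
qed

lemma cong_uf_iff:
  assumes "ultrafilter w" and "ultrafilter u" and "ultrafilter v"
  shows "cong_uf S w u v \<longleftrightarrow>
    (\<forall>P. eventually P w \<longrightarrow> (\<forall>\<^sub>F x in u. \<forall>\<^sub>F y in v. \<exists>n. P n \<and> n dvd x - y))"
proof -
  obtain a b where ab: "realises2 S (a, b) (u \<otimes> v)"
    using realise2[OF ultrafilter_tensor[OF assms(2,3)]] .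
  have *: "(\<exists>d. realises1 S d w \<and> star_dvd S d (star_diff S a b)) \<longleftrightarrow>
      (\<forall>P. eventually P w \<longrightarrow> (\<forall>\<^sub>F x in u. \<forall>\<^sub>F y in v. \<exists>n. P n \<and> n dvd x - y))"
    if "realises2 S (a, b) (u \<otimes> v)" for a b
  proof -
    have "ext S (\<lambda>l. \<exists>n. P n \<and> n dvd l ! 0 - l ! 1) [a, b] \<longleftrightarrow>
        (\<forall>\<^sub>F x in u. \<forall>\<^sub>F y in v. \<exists>n. P n \<and> n dvd x - y)" for P
      using that eventually_tensor[of "\<lambda>(x, y). \<exists>n. P n \<and> n dvd x - y" u v]
      by (simp add: realises2_iff[OF el])
    then show ?thesis
      using ex_realises1_ext_iff[OF assms(1), of "\<lambda>l. l ! 0 dvd l ! 1 - l ! 2" "[a, b]"]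
      by (simp add: star_diff_def star_dvd_op_iff[OF el])
  qed
  show ?thesis unfolding cong_uf_def using * ab by blast
qed

text \<open>Whether \<open>d\<close> divides the difference of \<open>a\<close> and \<open>b\<close>
  is part of the type of the triple, so all realisations of the tensor product agree.\<close>

lemma strong_cong_uf_iff:
  assumes "ultrafilter w" and "ultrafilter u" and "ultrafilter v"
  shows "strong_cong_uf S w u v \<longleftrightarrow> (\<forall>\<^sub>F n in w. \<forall>\<^sub>F x in u. \<forall>\<^sub>F y in v. n dvd x - y)"
proof -
  obtain d a b where dab: "realises3 S (d, a, b) (w \<otimes> u \<otimes> v)"
    using realise3[OF ultrafilter_tensor[OF assms(1) ultrafilter_tensor[OF assms(2,3)]]] .
  have *: "star_dvd S d (star_diff S a b) \<longleftrightarrow> (\<forall>\<^sub>F n in w. \<forall>\<^sub>F x in u. \<forall>\<^sub>F y in v. n dvd x - y)"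
    if "realises3 S (d, a, b) (w \<otimes> u \<otimes> v)" for d a b
    using that[unfolded realises3_iff[OF el], rule_format, of "\<lambda>(n, x, y). n dvd x - y"]
    by (simp add: star_diff_def star_dvd_op_iff[OF el] eventually_tensor)
  show ?thesis unfolding strong_cong_uf_def using * dab by blast
qed

lemma ex_realises1_dvd_gcd_iff:
  assumes "ultrafilter w"
  shows "(\<exists>c. realises1 S c w \<and> star_dvd S c (star_gcd S a b)) \<longleftrightarrow>
    (\<forall>P. eventually P w \<longrightarrow> ext S (\<lambda>l. \<exists>n. P n \<and> n dvd gcd (l ! 0) (l ! 1)) [a, b])"
  using ex_realises1_ext_iff[OF assms, of "\<lambda>l. l ! 0 dvd gcd (l ! 1) (l ! 2)" "[a, b]"]
  unfolding star_gcd_def star_dvd_op_iff[OF el] by simp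

end


section \<open>Residues of ultrafilters\<close>

text \<open>Bezout's identity, multiplied by the cofactor \<open>k\<close>, writes \<open>e\<close>
  as a multiple of \<open>d\<close> plus a multiple of \<open>d'\<close>; the former is
  \<open>b\<close>.\<close>

lemma ex_dvd_and_dvd_diff:
  fixes d d' e :: int
  assumes "gcd d d' dvd e"
  obtains b where "d dvd b" and "d' dvd b - e"
proof -
  obtain k where k: "e = gcd d d' * k" using assms by blast
  obtain x y where xy: "x * d + y * d' = gcd d d'" using bezout_int by blast
  have "x * k * d - e = d' * (- y * k)"
    unfolding k xy[symmetric] by (simp add: algebra_simps)
  then show ?thesis by (intro that[of "x * k * d"]) auto
qed

lemma INF_principal_neq_bot:
  assumes "\<And>i j. i \<in> I \<Longrightarrow> j \<in> I \<Longrightarrow> \<exists>k\<in>I. A k \<subseteq> A i \<inter> A j"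
    and "\<And>i. i \<in> I \<Longrightarrow> A i \<noteq> {}"
  shows "(INF i\<in>I. principal (A i)) \<noteq> bot"
  using INF_filter_bot_base[of I "\<lambda>i. principal (A i)"] assms
  by (auto simp: principal_eq_bot_iff)

lemma mem_D_iff: "n \<in> D u \<longleftrightarrow> (\<forall>\<^sub>F x in u. n dvd x)"
  by (auto simp: D_def dvd_def image_iff)

lemma D_dvd_closed: "n \<in> D u \<Longrightarrow> m dvd n \<Longrightarrow> m \<in> D u"
  unfolding mem_D_iff by (erule eventually_mono) (rule dvd_trans)

lemma D_lcm_closed: "m \<in> D u \<Longrightarrow> n \<in> D u \<Longrightarrow> lcm m n \<in> D u"
  unfolding mem_D_iff by (erule (1) eventually_elim2) (rule lcm_least)

lemma eventually_nonzero:
  assumes "w \<in> betaZ - {principal {0}}"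
  shows "\<forall>\<^sub>F n in w. n \<noteq> 0"
proof (rule ccontr)
  assume *: "\<not> ?thesis"
  from assms have w: "ultrafilter w" "w \<noteq> principal {0}" by (auto simp: betaZ_def)
  from w(1) * have 0: "\<forall>\<^sub>F n in w. n = 0" by (simp add: ultrafilter_iff)
  have "eventually P w \<longleftrightarrow> P 0" for P
  proof
    assume "eventually P w"
    with 0 have "\<forall>\<^sub>F n in w. P 0" by eventually_elim simp
    with w(1) show "P 0" by (simp add: ultrafilter_def eventually_const)
  next
    assume "P 0"
    from 0 show "eventually P w" by eventually_elim (simp add: \<open>P 0\<close>)
  qed
  then have "w = principal {0}" by (simp add: filter_eq_iff eventually_principal)
  with w(2) show False ..
qed

text \<open>Finitely many residue classes cover the integers, so one of them belongs to
  \<open>u\<close>.\<close>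

lemma ultrafilter_mod:
  fixes u :: "int filter"
  assumes "ultrafilter u" and "n \<noteq> 0"
  obtains r where "\<forall>\<^sub>F x in u. x mod n = r"
proof -
  have "finite (range (\<lambda>x. x mod n))"
  proof (rule finite_subset)
    \<comment> \<open>The bound is two-sided since \<open>mod\<close> takes the sign of
      \<open>n\<close>, which may be negative.\<close>
    show "range (\<lambda>x. x mod n) \<subseteq> {- \<bar>n\<bar>..\<bar>n\<bar>}"
    proof clarify
      fix x :: int
      show "x mod n \<in> {- \<bar>n\<bar>..\<bar>n\<bar>}" using abs_mod_less[OF assms(2), of x] by auto
    qed
  qed simp
  have "\<exists>r. \<forall>\<^sub>F x in u. x mod n = r"
  proof (rule ccontr)
    assume "\<nexists>r. \<forall>\<^sub>F x in u. x mod n = r"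
    with assms(1) have "\<forall>\<^sub>F x in u. x mod n \<noteq> r" for r by (simp add: ultrafilter_iff)
    then have *: "\<forall>\<^sub>F x in u. \<forall>r\<in>range (\<lambda>x. x mod n). x mod n \<noteq> r"
      using \<open>finite _\<close> by (intro eventually_ball_finite) auto
    have "\<forall>\<^sub>F x in u. False" using * by eventually_elim blast
    with assms(1) show False by (simp add: ultrafilter_def eventually_const)
  qed
  with that show ?thesis by blast
qed

text \<open>Once \<open>x mod n\<close> is constant along \<open>u\<close>, the condition concerns
  \<open>y\<close> alone. The form with a common residue shows the symmetry between \<open>u\<close>
  and \<open>v\<close>.\<close>

lemma eventually_dvd_diff_iff:
  fixes u v :: "int filter"
  assumes "ultrafilter u" and "ultrafilter v" and "n \<noteq> 0"
  shows "(\<forall>\<^sub>F x in u. \<forall>\<^sub>F y in v. n dvd x - y) \<longleftrightarrow>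
    (\<exists>r. (\<forall>\<^sub>F x in u. x mod n = r) \<and> (\<forall>\<^sub>F y in v. y mod n = r))"
proof -
  obtain r where r: "\<forall>\<^sub>F x in u. x mod n = r" using ultrafilter_mod assms by metis
  have nb: "u \<noteq> bot" using assms(1) by (simp add: ultrafilter_def)
  have "(\<forall>\<^sub>F x in u. \<forall>\<^sub>F y in v. n dvd x - y) \<longleftrightarrow> (\<forall>\<^sub>F x in u. \<forall>\<^sub>F y in v. y mod n = r)"
    by (rule eventually_cong[OF r]) (auto simp: mod_eq_dvd_iff[symmetric] elim!: eventually_mono)
  also have "\<dots> \<longleftrightarrow> (\<forall>\<^sub>F y in v. y mod n = r)"
    using nb by (simp add: eventually_const)
  also have "\<dots> \<longleftrightarrow> (\<exists>r. (\<forall>\<^sub>F x in u. x mod n = r) \<and> (\<forall>\<^sub>F y in v. y mod n = r))"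
  proof
    assume "\<exists>r. (\<forall>\<^sub>F x in u. x mod n = r) \<and> (\<forall>\<^sub>F y in v. y mod n = r)"
    then obtain s where s: "\<forall>\<^sub>F x in u. x mod n = s" "\<forall>\<^sub>F y in v. y mod n = s" by blast
    have "\<forall>\<^sub>F x in u. s = r" using r s(1) by eventually_elim simp
    then show "\<forall>\<^sub>F y in v. y mod n = r" using s(2) nb by (simp add: eventually_const)
  qed (use r in blast)
  finally show ?thesis .
qed


section \<open>Self-divisibility\<close>

context
  fixes S :: "'a structure" and j :: "int \<Rightarrow> 'a" and w :: "int filter"
  assumes el: "elementary_extension S j" and sat: "saturated S"
    and w: "w \<in> betaZ - {principal {0}}"
begin

lemma ultrafilter_w: "ultrafilter w"
  using w by (simp add: betaZ_def)

lemma eventually_nonzero_w: "\<forall>\<^sub>F n in w. n \<noteq> 0"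
  by (rule eventually_nonzero[OF w])

section \<open>Consequences of self-divisibility\<close>

lemma self_divisible_realise:
  assumes "self_divisible w" and "eventually P w"
  obtains n where "P n" and "n \<in> D w"
proof -
  have "\<forall>\<^sub>F n in w. P n \<and> n \<in> D w"
    using assms unfolding self_divisible_def by (simp add: eventually_conj)
  then show ?thesis
    using that ultrafilter_w eventually_happens[of _ w] unfolding ultrafilter_def by blast
qed

text \<open>For \<open>n\<close> in \<open>D w\<close> the multiples of \<open>n\<close> form a
  member of \<open>w\<close>; the divisibility criterion is applied to this member.\<close>

lemma tilde_dvd_D:
  assumes "ultrafilter u" and "tilde_dvd S w u"
  shows "D w \<subseteq> D u"
proof
  fix n assume "n \<in> D w"
  then have "\<forall>\<^sub>F y in u. \<exists>m. n dvd m \<and> m dvd y"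
    using assms by (simp add: tilde_dvd_iff[OF el sat ultrafilter_w] mem_D_iff)
  then show "n \<in> D u" unfolding mem_D_iff by eventually_elim (metis dvd_trans)
qed

lemma self_divisible_tilde_dvd_iff:
  assumes "self_divisible w" and "ultrafilter u"
  shows "tilde_dvd S w u \<longleftrightarrow> D w \<subseteq> D u"
proof
  assume *: "D w \<subseteq> D u"
  have "\<forall>\<^sub>F y in u. \<exists>n. P n \<and> n dvd y" if P: "eventually P w" for P
  proof -
    obtain n where "P n" "n \<in> D w" using self_divisible_realise[OF assms(1) P] .
    with * have "\<forall>\<^sub>F y in u. n dvd y" by (auto simp: mem_D_iff[symmetric])
    then show ?thesis by eventually_elim (use \<open>P n\<close> in blast)
  qed
  then show "tilde_dvd S w u" by (simp add: tilde_dvd_iff[OF el sat ultrafilter_w assms(2)])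
qed (rule tilde_dvd_D[OF assms(2)])

text \<open>The strong relation supplies one \<open>n\<close> in the given member of
  \<open>w\<close> that serves most pairs at once, whereas the weak one lets \<open>n\<close> vary
  with the pair.\<close>

lemma strong_cong_imp_cong:
  assumes "ultrafilter u" and "ultrafilter v" and "strong_cong_uf S w u v"
  shows "cong_uf S w u v"
  unfolding cong_uf_iff[OF el sat ultrafilter_w assms(1,2)]
proof (intro allI impI)
  fix P assume "eventually P w"
  moreover have "\<forall>\<^sub>F n in w. \<forall>\<^sub>F x in u. \<forall>\<^sub>F y in v. n dvd x - y"
    using assms by (simp add: strong_cong_uf_iff[OF el sat ultrafilter_w])
  ultimately have "\<forall>\<^sub>F n in w. P n \<and> (\<forall>\<^sub>F x in u. \<forall>\<^sub>F y in v. n dvd x - y)"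
    by (rule eventually_conj)
  then obtain n where n: "P n" "\<forall>\<^sub>F x in u. \<forall>\<^sub>F y in v. n dvd x - y"
    using ultrafilter_w eventually_happens[of _ w] unfolding ultrafilter_def by blast
  show "\<forall>\<^sub>F x in u. \<forall>\<^sub>F y in v. \<exists>n. P n \<and> n dvd x - y"
    by (rule eventually_mono[OF n(2)], erule eventually_mono) (use n(1) in blast)
qed

text \<open>Applied to the multiples of \<open>n\<close> in \<open>D w\<close>, the weak congruence
  makes \<open>n\<close> itself divide most differences; self-divisibility says that most
  \<open>n\<close> are of this kind.\<close>

lemma self_divisible_cong_imp_strong:
  assumes "self_divisible w" and "ultrafilter u" and "ultrafilter v" and "cong_uf S w u v"
  shows "strong_cong_uf S w u v"
proof -
  have "\<forall>\<^sub>F x in u. \<forall>\<^sub>F y in v. n dvd x - y" if "n \<in> D w" for n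
  proof -
    have "\<forall>\<^sub>F x in u. \<forall>\<^sub>F y in v. \<exists>m. n dvd m \<and> m dvd x - y"
      using assms(4) that by (simp add: cong_uf_iff[OF el sat ultrafilter_w assms(2,3)] mem_D_iff)
    then show ?thesis
      by (rule eventually_mono, elim eventually_mono) (metis dvd_trans)
  qed
  with assms(1) show ?thesis
    unfolding strong_cong_uf_iff[OF el sat ultrafilter_w assms(2,3)] self_divisible_def
    by (auto elim: eventually_mono)
qed

text \<open>Strong congruence means that \<open>u\<close> and \<open>v\<close> have the same residue
  modulo \<open>w\<close>-most \<open>n\<close>; transitivity holds because the residue of the
  middle ultrafilter is unique.\<close>

lemma equiv_strong_cong:
  "equiv betaZ {(u, v). u \<in> betaZ \<and> v \<in> betaZ \<and> strong_cong_uf S w u v}"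
proof -
  have iff: "strong_cong_uf S w u v \<longleftrightarrow>
      (\<forall>\<^sub>F n in w. \<exists>r. (\<forall>\<^sub>F x in u. x mod n = r) \<and> (\<forall>\<^sub>F y in v. y mod n = r))"
    if "ultrafilter u" "ultrafilter v" for u v
    unfolding strong_cong_uf_iff[OF el sat ultrafilter_w that]
    by (rule eventually_cong[OF eventually_nonzero_w]) (rule eventually_dvd_diff_iff[OF that])
  show ?thesis
  proof (rule equivI)
    show "refl_on betaZ {(u, v). u \<in> betaZ \<and> v \<in> betaZ \<and> strong_cong_uf S w u v}"
    proof (rule refl_onI)
      fix u assume u: "u \<in> betaZ"
      then have "strong_cong_uf S w u u"
        unfolding betaZ_def mem_Collect_eq
        by (subst iff) (auto intro!: eventually_mono[OF eventually_nonzero_w] elim: ultrafilter_mod)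
      with u show "(u, u) \<in> {(u, v). u \<in> betaZ \<and> v \<in> betaZ \<and> strong_cong_uf S w u v}" by simp
    qed
    show "sym {(u, v). u \<in> betaZ \<and> v \<in> betaZ \<and> strong_cong_uf S w u v}"
      by (rule symI) (auto simp: betaZ_def iff conj_commute)
    show "trans {(u, v). u \<in> betaZ \<and> v \<in> betaZ \<and> strong_cong_uf S w u v}"
    proof (rule transI, clarsimp simp: betaZ_def iff)
      fix u v t :: "int filter"
      assume v: "ultrafilter v"
      assume "\<forall>\<^sub>F n in w. \<exists>r. (\<forall>\<^sub>F x in u. x mod n = r) \<and> (\<forall>\<^sub>F y in v. y mod n = r)"
        and "\<forall>\<^sub>F n in w. \<exists>r. (\<forall>\<^sub>F x in v. x mod n = r) \<and> (\<forall>\<^sub>F y in t. y mod n = r)"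
      then show "\<forall>\<^sub>F n in w. \<exists>r. (\<forall>\<^sub>F x in u. x mod n = r) \<and> (\<forall>\<^sub>F y in t. y mod n = r)"
      proof eventually_elim
        case (elim n)
        then obtain r s where rs: "\<forall>\<^sub>F x in u. x mod n = r" "\<forall>\<^sub>F x in v. x mod n = r"
          "\<forall>\<^sub>F x in v. x mod n = s" "\<forall>\<^sub>F x in t. x mod n = s" by blast
        from rs(2,3) have "\<forall>\<^sub>F x in v. r = s" by eventually_elim simp
        with v have "r = s" by (simp add: ultrafilter_def eventually_const)
        with rs show ?case by blast
      qed
    qed
  qed auto
qed

section \<open>Witnesses for the converse implications\<close>

lemma self_divisible_witness:
  obtains t where "ultrafilter t" and "D w \<subseteq> D t" and "\<forall>\<^sub>F x in t. x \<in> D w"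
proof -
  \<comment> \<open>Each \<open>?A n\<close> contains \<open>n\<close>, and least common multiples
    make the family directed.\<close>
  let ?A = "\<lambda>n. {x. n dvd x \<and> x \<in> D w}"
  have one: "1 \<in> D w" by (simp add: mem_D_iff)
  have "(INF n\<in>D w. principal (?A n)) \<noteq> bot"
  proof (rule INF_principal_neq_bot)
    show "\<exists>k\<in>D w. ?A k \<subseteq> ?A m \<inter> ?A n" if "m \<in> D w" "n \<in> D w" for m n
      using D_lcm_closed[OF that] by (intro bexI[of _ "lcm m n"]) auto
    show "?A n \<noteq> {}" if "n \<in> D w" for n
    proof -
      from that have "n \<in> ?A n" by simp
      then show ?thesis by blast
    qed
  qed
  then obtain t where t: "ultrafilter t" "t \<le> (INF n\<in>D w. principal (?A n))"
    using ultrafilter_below[OF el sat] by blast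
  then have le: "t \<le> principal (?A n)" if "n \<in> D w" for n
    using that by (meson INF_lower order_trans)
  show ?thesis
  proof (rule that)
    show "D w \<subseteq> D t"
      using le unfolding mem_D_iff[of _ t] subset_iff le_principal
      by (blast intro: eventually_mono)
    show "\<forall>\<^sub>F x in t. x \<in> D w"
      using le[OF one] by (auto simp: le_principal elim: eventually_mono)
  qed (rule t)
qed

text \<open>Otherwise the complement of \<open>D w\<close> is in \<open>w\<close>, so most
  \<open>x\<close> in \<open>D w\<close> have a divisor outside \<open>D w\<close>, against closure
  under divisors.\<close>

lemma self_divisible_if_dvd:
  assumes "u \<noteq> bot" and "\<forall>\<^sub>F x in u. x \<in> D w"
    and "\<And>P. eventually P w \<Longrightarrow> \<forall>\<^sub>F x in u. \<exists>n. P n \<and> n dvd x"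
  shows "self_divisible w"
proof (rule ccontr)
  assume "\<not> self_divisible w"
  then have "\<forall>\<^sub>F n in w. n \<notin> D w"
    using ultrafilter_w by (simp add: self_divisible_def ultrafilter_iff)
  from assms(3)[OF this] assms(2) have "\<forall>\<^sub>F x in u. False"
    by eventually_elim (blast intro: D_dvd_closed)
  with assms(1) show False by (simp add: eventually_const)
qed

lemma self_divisible_if_tilde_dvd:
  assumes "\<forall>u\<in>betaZ. tilde_dvd S w u \<longleftrightarrow> D w \<subseteq> D u"
  shows "self_divisible w"
proof -
  obtain t where t: "ultrafilter t" "D w \<subseteq> D t" "\<forall>\<^sub>F x in t. x \<in> D w"
    using self_divisible_witness .
  with assms have "tilde_dvd S w t" by (auto simp: betaZ_def)
  with t(1) show ?thesis
    by (intro self_divisible_if_dvd[OF _ t(3)])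
      (auto simp: tilde_dvd_iff[OF el sat ultrafilter_w t(1)] ultrafilter_def)
qed

text \<open>\<open>gcd d e\<close> depends only on \<open>e mod d\<close>, which is constant along \<open>w\<close>.\<close>

lemma eventually_gcd_mem_D:
  assumes "d \<noteq> 0"
  shows "\<forall>\<^sub>F e in w. gcd d e \<in> D w"
proof -
  obtain r where r: "\<forall>\<^sub>F e in w. e mod d = r" using ultrafilter_mod[OF ultrafilter_w assms] .
  then have "\<forall>\<^sub>F e in w. gcd d e = gcd d r"
    by eventually_elim (metis gcd.commute gcd_red_int)
  then show ?thesis
  proof eventually_elim
    \<comment> \<open>The common value \<open>gcd d r\<close> divides every integer with residue
      \<open>r\<close> modulo \<open>d\<close>, hence \<open>w\<close>-most integers.\<close>
    case (elim e)
    have "\<forall>\<^sub>F e in w. gcd d r dvd e"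
      using r by eventually_elim (metis gcd.commute gcd_red_int gcd_dvd2)
    with elim show ?case by (simp add: mem_D_iff)
  qed
qed

text \<open>
  By the Chinese remainder theorem, a multiple \<open>b\<close> of \<open>d\<close> can be chosen congruent to \<open>t\<close> modulo
  \<open>d'\<close> as soon as \<open>gcd d d'\<close> divides \<open>t\<close>, and for most \<open>d, d'\<close> this gcd lies in \<open>D w\<close>.
\<close>

lemma cong_uf_chain:
  assumes t: "ultrafilter t" and D: "D w \<subseteq> D t"
  obtains s where "ultrafilter s" and "cong_uf S w (principal {0}) s" and "cong_uf S w s t"
proof -
  \<comment> \<open>The first clause prepares the congruence of \<open>0\<close> and
    \<open>s\<close>, the second that of \<open>s\<close> and \<open>t\<close>.\<close>
  let ?A = "\<lambda>P. {b. (\<exists>n. P n \<and> n dvd b) \<and> (\<forall>\<^sub>F e in t. \<exists>n. P n \<and> n dvd b - e)}"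
  let ?W = "{P. eventually P w}"
  have nonempty: "?A P \<noteq> {}" if P: "eventually P w" for P
  proof -
    obtain d where d: "P d" "d \<noteq> 0"
      using eventually_happens[OF eventually_conj[OF P eventually_nonzero_w]] ultrafilter_w by (auto simp: ultrafilter_def)
    \<comment> \<open>Choosing \<open>d'\<close> after \<open>d\<close> puts the gcd into
      \<open>D w\<close>, and by \<open>D\<close> into \<open>D t\<close>, so that it divides
      \<open>t\<close>-most integers.\<close>
    obtain d' where d': "P d'" "d' \<noteq> 0" "gcd d d' \<in> D w"
      using eventually_happens[OF eventually_conj[OF P eventually_conj[OF eventually_nonzero_w eventually_gcd_mem_D[OF d(2)]]]]
        ultrafilter_w by (auto simp: ultrafilter_def)
    obtain r where r: "\<forall>\<^sub>F e in t. e mod d' = r" using ultrafilter_mod[OF t d'(2)] .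
    have "\<forall>\<^sub>F e in t. gcd d d' dvd e" using D d'(3) by (auto simp: mem_D_iff[symmetric])
    \<comment> \<open>Solving for one \<open>e\<close> is enough, since \<open>t\<close>-most
      integers share its residue modulo \<open>d'\<close>.\<close>
    from eventually_happens[OF eventually_conj[OF r this]] obtain e
      where e: "e mod d' = r" "gcd d d' dvd e"
      using t by (auto simp: ultrafilter_def)
    obtain b where b: "d dvd b" "d' dvd b - e" using ex_dvd_and_dvd_diff[OF e(2)] .
    have "\<forall>\<^sub>F e in t. d' dvd b - e"
      using r by eventually_elim (metis b(2) e(1) mod_eq_dvd_iff)
    then have "\<forall>\<^sub>F e in t. \<exists>n. P n \<and> n dvd b - e"
      by eventually_elim (use d' in blast)
    with d(1) b(1) show ?thesis by blast
  qed
  have "(INF P\<in>?W. principal (?A P)) \<noteq> bot"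
  proof (rule INF_principal_neq_bot)
    show "\<exists>R\<in>?W. ?A R \<subseteq> ?A P \<inter> ?A Q" if "P \<in> ?W" "Q \<in> ?W" for P Q
      using that
      by (intro bexI[of _ "\<lambda>n. P n \<and> Q n"]) (auto simp: eventually_conj elim: eventually_mono)
    show "?A P \<noteq> {}" if "P \<in> ?W" for P
      using nonempty that by simp
  qed
  then obtain s where s: "ultrafilter s" "s \<le> (INF P\<in>?W. principal (?A P))"
    using ultrafilter_below[OF el sat] by blast
  have ev: "\<forall>\<^sub>F b in s. b \<in> ?A P" if "eventually P w" for P
  proof -
    have "s \<le> principal (?A P)" using that s(2) by (meson INF_lower order_trans mem_Collect_eq)
    then show ?thesis by (simp add: le_principal)
  qed
  show ?thesis
  proof (rule that[OF s(1)])
    show "cong_uf S w (principal {0}) s"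
      unfolding cong_uf_iff[OF el sat ultrafilter_w ultrafilter_principal s(1)] eventually_principal
      by (auto dest!: ev elim!: eventually_mono)
    show "cong_uf S w s t"
      unfolding cong_uf_iff[OF el sat ultrafilter_w s(1) t]
      by (auto dest!: ev elim: eventually_mono)
  qed
qed

text \<open>Transitivity through \<open>s\<close> makes \<open>0\<close> congruent to
  \<open>t\<close>, which up to sign says that \<open>w\<close> divides \<open>t\<close>.\<close>

lemma self_divisible_if_equiv:
  assumes "equiv betaZ {(u, v). u \<in> betaZ \<and> v \<in> betaZ \<and> cong_uf S w u v}"
  shows "self_divisible w"
proof -
  obtain t where t: "ultrafilter t" "D w \<subseteq> D t" "\<forall>\<^sub>F x in t. x \<in> D w"
    using self_divisible_witness .
  obtain s where s: "ultrafilter s" "cong_uf S w (principal {0}) s" "cong_uf S w s t"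
    using cong_uf_chain[OF t(1,2)] .
  have "trans {(u, v). u \<in> betaZ \<and> v \<in> betaZ \<and> cong_uf S w u v}"
    using assms by (rule equivE)
  from transD[OF this, of "principal {0}" s t] have "cong_uf S w (principal {0}) t"
    using s t(1) by (simp add: betaZ_def ultrafilter_principal)
  then show ?thesis
    using t(1) by (intro self_divisible_if_dvd[OF _ t(3)])
      (auto simp: cong_uf_iff[OF el sat ultrafilter_w ultrafilter_principal t(1)] eventually_principal ultrafilter_def)
qed

section \<open>Common divisors of two realisations\<close>

lemma self_divisible_gcd:
  assumes "self_divisible w" and "realises1 S a w" and "realises1 S b w"
  shows "\<exists>c. realises1 S c w \<and> star_dvd S c (star_gcd S a b)"
  unfolding ex_realises1_dvd_gcd_iff[OF el sat ultrafilter_w]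
proof (intro allI impI)
  fix P assume "eventually P w"
  then obtain n where n: "P n" "n \<in> D w" using self_divisible_realise[OF assms(1)] by blast
  \<comment> \<open>The standard integer \<open>n\<close> has its multiples in \<open>w\<close>, so
    it divides every realisation of \<open>w\<close>.\<close>
  then have "ext S (\<lambda>l. n dvd l ! 0) [a]" "ext S (\<lambda>l. n dvd l ! 0) [b]"
    using assms(2,3) by (auto simp: realises1_iff[OF el] mem_D_iff)
  then have "ext S (\<lambda>l. n dvd l ! 0 \<and> n dvd l ! 1) [a, b]"
    using ext_map[OF el, of "[0]" "[a, b]" "\<lambda>l. n dvd l ! 0"]
      ext_map[OF el, of "[1]" "[a, b]" "\<lambda>l. n dvd l ! 0"]
    by (simp add: ext_conj[OF el])
  then show "ext S (\<lambda>l. \<exists>n. P n \<and> n dvd gcd (l ! 0) (l ! 1)) [a, b]"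
    by (rule ext_mono[OF el]) (use n(1) in auto)
qed

lemma self_divisible_if_gcd:
  assumes "\<And>a b. realises1 S a w \<Longrightarrow> realises1 S b w \<Longrightarrow>
    \<exists>c. realises1 S c w \<and> star_dvd S c (star_gcd S a b)"
  shows "self_divisible w"
proof -
  obtain a b where ab: "realises2 S (a, b) (w \<otimes> w)"
    using realise2[OF el sat ultrafilter_tensor[OF ultrafilter_w ultrafilter_w]] .
  have ext: "ext S (\<lambda>l. P (l ! 0) (l ! 1)) [a, b] \<longleftrightarrow> (\<forall>\<^sub>F x in w. \<forall>\<^sub>F y in w. P x y)" for P
    using ab[unfolded realises2_iff[OF el], rule_format, of "\<lambda>(x, y). P x y"]
    by (simp add: eventually_tensor)
  have nb: "w \<noteq> bot" using ultrafilter_w by (simp add: ultrafilter_def)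
  \<comment> \<open>A predicate of one coordinate is constant in the other, and \<open>w\<close> is
    proper; so each coordinate of the tensor pair realises \<open>w\<close>.\<close>
  have a: "realises1 S a w"
    using ext[of "\<lambda>x y. _ x"] ext_map[OF el, of "[0]" "[a, b]" "\<lambda>l. _ (l ! 0)"] nb
    by (simp add: realises1_iff[OF el] eventually_const)
  have b: "realises1 S b w"
    using ext[of "\<lambda>x y. _ y"] ext_map[OF el, of "[1]" "[a, b]" "\<lambda>l. _ (l ! 0)"] nb
    by (simp add: realises1_iff[OF el] eventually_const)
  have *: "\<forall>\<^sub>F x in w. \<forall>\<^sub>F y in w. \<exists>n. P n \<and> n dvd gcd x y" if "eventually P w" for P
  proof -
    have "ext S (\<lambda>l. \<exists>n. P n \<and> n dvd gcd (l ! 0) (l ! 1)) [a, b]"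
      using assms[OF a b] that unfolding ex_realises1_dvd_gcd_iff[OF el sat ultrafilter_w] by blast
    then show ?thesis by (simp only: ext[of "\<lambda>x y. \<exists>n. P n \<and> n dvd gcd x y"])
  qed
  show ?thesis
  proof (rule ccontr)
    assume "\<not> self_divisible w"
    then have "\<forall>\<^sub>F n in w. n \<notin> D w"
      using ultrafilter_w by (simp add: self_divisible_def ultrafilter_iff)
    from *[OF this] eventually_nonzero_w have "\<forall>\<^sub>F x in w. False"
    proof eventually_elim
      \<comment> \<open>For this nonzero \<open>x\<close>, most \<open>y\<close> have
        \<open>gcd x y\<close> in \<open>D w\<close>, hence all divisors of it as well; yet most
        gcds have a divisor outside \<open>D w\<close>.\<close>
      case (elim x)
      from eventually_gcd_mem_D[OF elim(2)] elim(1) have "\<forall>\<^sub>F y in w. False"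
        by eventually_elim (blast intro: D_dvd_closed)
      with nb show ?case by (simp add: eventually_const)
    qed
    with nb show False by (simp add: eventually_const)
  qed
qed

end

theorem theorem3p10:
  fixes S :: "'a structure" and j :: "int \<Rightarrow> 'a" and w :: "int filter"
  assumes "elementary_extension S j" and "saturated S"
    and "w \<in> betaZ - {principal {0}}"
  shows
    "(self_divisible w \<longleftrightarrow>
        (\<forall>u\<in>betaZ. \<forall>v\<in>betaZ. cong_uf S w u v \<longleftrightarrow> strong_cong_uf S w u v)) \<and>
     (self_divisible w \<longleftrightarrow>
        equiv betaZ {(u, v). u \<in> betaZ \<and> v \<in> betaZ \<and> cong_uf S w u v}) \<and>
     (self_divisible w \<longleftrightarrow>
        (\<forall>u\<in>betaZ. tilde_dvd S w u \<longleftrightarrow> D w \<subseteq> D u)) \<and>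
     (self_divisible w \<longleftrightarrow>
        (\<forall>a b. realises1 S a w \<longrightarrow> realises1 S b w \<longrightarrow>
           (\<exists>c. realises1 S c w \<and> star_dvd S c (star_gcd S a b))))"
proof -
  let ?c2 = "\<forall>u\<in>betaZ. \<forall>v\<in>betaZ. cong_uf S w u v \<longleftrightarrow> strong_cong_uf S w u v"
  let ?c3 = "equiv betaZ {(u, v). u \<in> betaZ \<and> v \<in> betaZ \<and> cong_uf S w u v}"
  have "?c2" if "self_divisible w"
    using self_divisible_cong_imp_strong[OF assms that] strong_cong_imp_cong[OF assms]
    by (auto simp: betaZ_def)
  moreover have "?c3" if ?c2
  proof -
    have "{(u, v). u \<in> betaZ \<and> v \<in> betaZ \<and> cong_uf S w u v} =
        {(u, v). u \<in> betaZ \<and> v \<in> betaZ \<and> strong_cong_uf S w u v}"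
      using that by auto
    then show ?thesis using equiv_strong_cong[OF assms] by simp
  qed
  moreover have "self_divisible w" if ?c3
    by (rule self_divisible_if_equiv[OF assms that])
  moreover have "self_divisible w \<longleftrightarrow> (\<forall>u\<in>betaZ. tilde_dvd S w u \<longleftrightarrow> D w \<subseteq> D u)"
    using self_divisible_tilde_dvd_iff[OF assms] self_divisible_if_tilde_dvd[OF assms]
    by (auto simp: betaZ_def)
  moreover have "self_divisible w \<longleftrightarrow>
      (\<forall>a b. realises1 S a w \<longrightarrow> realises1 S b w \<longrightarrow>
         (\<exists>c. realises1 S c w \<and> star_dvd S c (star_gcd S a b)))"
    using self_divisible_gcd[OF assms] self_divisible_if_gcd[OF assms] by blast
  ultimately show ?thesis by blast
qed

end
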